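(* Let $D$ be a (nonempty) finite set of positive integers. If $D$ is symmetric with offset of symmetry $k$, then there is a winner for $D$ and it is periodic, with period dividing $k$.
   Context: $\mathbb{N}=\{0,1,2,\dots\}$. For $S\subseteq\mathbb{N}$ put $S_q=\sum_{n\in S}q^n$ for $q\in(0,1)$. For $S,S'\subseteq\mathbb{N}$ write $S'\preceq S$ (the germ order) iff there exists $\epsilon>0$ such that $S'_q\le S_q$ for all $q\in(1-\epsilon,1)$. A set $S\subseteq\mathbb{N}$ is $D$-avoiding if no two elements of $S$ differ by an element of $D$. A $D$-avoiding set $S$ is the winner for $D$ if $S'\preceq S$ for every $D$-avoiding set $S'\subseteq\mathbb{N}$. Write $\|D\|$ for the largest element of $D$. The set $D$ is symmetric if there is an integer $k>\|D\|$ such that for all integers $i$, $i\in D$ iff $k-i\in D$; the number $k$ is called the offset of symmetry for $D$. A set $S\subseteq\mathbb{N}$ is periodic with period $d\ge 1$ if for all $n\in\mathbb{N}$, $n\in S$ iff $n+d\in S$. *)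

theory Defs
  imports "HOL-Analysis.Analysis"
begin

definition gen_sum :: "nat set \<Rightarrow> real \<Rightarrow> real" where
  "gen_sum S q = (\<Sum>\<^sub>\<infinity>n\<in>S. q ^ n)"

text \<open>The bound \<open>\<epsilon> \<le> 1\<close> keeps \<open>q\<close> inside \<open>(0, 1)\<close>, where \<open>gen_sum\<close> is meaningful.
  Shrinking \<open>\<epsilon>\<close> only weakens the condition, so the order is not affected by it.\<close>

definition germ_le :: "nat set \<Rightarrow> nat set \<Rightarrow> bool" (infix "\<preceq>" 50) where
  "S' \<preceq> S \<longleftrightarrow>
     (\<exists>\<epsilon>::real. 0 < \<epsilon> \<and> \<epsilon> \<le> 1 \<and> (\<forall>q\<in>{1 - \<epsilon><..<1}. gen_sum S' q \<le> gen_sum S q))"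

definition avoiding :: "nat set \<Rightarrow> nat set \<Rightarrow> bool" where
  "avoiding D S \<longleftrightarrow> (\<forall>x\<in>S. \<forall>y\<in>S. x < y \<longrightarrow> y - x \<notin> D)"

definition winner :: "nat set \<Rightarrow> nat set \<Rightarrow> bool" where
  "winner D S \<longleftrightarrow> avoiding D S \<and> (\<forall>S'. avoiding D S' \<longrightarrow> S' \<preceq> S)"

text \<open>The index \<open>i\<close> ranges over the integers, so that \<open>k - i\<close> is not truncated.\<close>

definition symmetric_with_offset :: "nat set \<Rightarrow> nat \<Rightarrow> bool" where
  "symmetric_with_offset D k \<longleftrightarrow>
     Max D < k \<and> (\<forall>i::int. i \<in> int ` D \<longleftrightarrow> int k - i \<in> int ` D)"

definition periodic_with_period :: "nat set \<Rightarrow> nat \<Rightarrow> bool" where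
  "periodic_with_period S d \<longleftrightarrow> 1 \<le> d \<and> (\<forall>n. n \<in> S \<longleftrightarrow> n + d \<in> S)"

end

theory Submission
  imports Defs "HOL-Computational_Algebra.Polynomial"
begin

text \<open>
  If \<open>D\<close> is symmetric with offset \<open>k\<close>, then for \<open>0 < j < k\<close> the condition \<open>j \<in> D\<close> depends only on
  the class of \<open>\<plusminus>j\<close> modulo \<open>k\<close>. A \<open>D\<close>-avoiding subset of \<open>{0..<k}\<close> is therefore the same thing as
  an independent set of the circulant graph on \<open>\<int>/k\<close> with connection set \<open>D\<close>, and such a set can be
  repeated with period \<open>k\<close> without creating a forbidden difference (\<open>avoiding_periodic_extension\<close>).
  Conversely, cutting any \<open>D\<close>-avoiding set into blocks of length \<open>k\<close> yields a sequence of
  \<open>D\<close>-avoiding subsets of \<open>{0..<k}\<close>.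

  There are only finitely many candidates for a block. Their generating functions are polynomials,
  and two polynomials are always comparable just to the left of \<open>1\<close> (\<open>poly_sign_at_left\<close>), so one
  candidate \<open>I\<close> is at least as good as all the others on a common interval \<open>(1 - \<epsilon>, 1)\<close>.
  Since \<open>S\<^sub>q\<close> is the sum of \<open>q\<^bsup>nk\<^esup>\<close> times the generating function of the \<open>n\<close>-th block of \<open>S\<close>
  (\<open>gen_sum_blocks\<close>), repeating \<open>I\<close> in every block beats every competitor block by block, hence
  is a winner; its period is \<open>k\<close> itself.
\<close>

text \<open>A nonzero polynomial is a power of \<open>x - a\<close>, whose sign is constant for \<open>x < a\<close>, times a
  polynomial that does not vanish at \<open>a\<close> and so keeps its sign nearby.\<close>

lemma poly_sign_at_left:
  fixes p :: "real poly"
  shows "(\<forall>\<^sub>F x in at_left a. 0 \<le> poly p x) \<or> (\<forall>\<^sub>F x in at_left a. poly p x \<le> 0)"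
proof (cases "p = 0")
  case False
  obtain r where p: "p = [:-a, 1:] ^ order a p * r" and "\<not> [:-a, 1:] dvd r"
    using order_decomp[OF False] by blast
  then have r_nz: "poly r a \<noteq> 0"
    by (simp add: poly_eq_0_iff_dvd)
  have poly_p: "poly p x = (x - a) ^ order a p * poly r x" for x
    by (subst p) (simp add: poly_power)
  have lim: "(poly r \<longlongrightarrow> poly r a) (at_left a)"
    by (intro tendsto_intros)
  have r_sign: "(\<forall>\<^sub>F x in at_left a. 0 < poly r x) \<or> (\<forall>\<^sub>F x in at_left a. poly r x < 0)"
    using r_nz order_tendstoD[OF lim] by (meson linorder_neqE_linordered_idom)
  have left: "\<forall>\<^sub>F x in at_left a. x < a"
    by (simp add: eventually_at_filter)
  show ?thesis
  proof (cases "even (order a p)")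
    case True
    then have pos: "0 \<le> (x - a) ^ order a p" for x
      by (simp add: zero_le_even_power)
    have "0 \<le> poly p x" if "0 < poly r x" for x
      using that pos by (simp add: poly_p)
    moreover have "poly p x \<le> 0" if "poly r x < 0" for x
      using that pos by (simp add: poly_p mult_nonneg_nonpos)
    ultimately show ?thesis
      using r_sign by (metis (mono_tags, lifting) eventually_mono)
  next
    case odd: False
    have neg: "(x - a) ^ order a p \<le> 0" if "x < a" for x
      using odd that by (simp add: power_le_zero_eq odd_pos)
    from r_sign show ?thesis
    proof
      assume "\<forall>\<^sub>F x in at_left a. 0 < poly r x"
      with left have "\<forall>\<^sub>F x in at_left a. poly p x \<le> 0"
        by eventually_elim (simp add: poly_p neg mult_nonpos_nonneg)
      then show ?thesis ..
    next
      assume "\<forall>\<^sub>F x in at_left a. poly r x < 0"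
      with left have "\<forall>\<^sub>F x in at_left a. 0 \<le> poly p x"
        by eventually_elim (simp add: poly_p neg mult_nonpos_nonpos)
      then show ?thesis ..
    qed
  qed
qed simp

lemma finite_set_polys_comparable_at_left:
  fixes A B :: "nat set" and a :: real
  assumes "finite A" "finite B"
  shows "(\<forall>\<^sub>F q in at_left a. (\<Sum>i\<in>A. q ^ i) \<le> (\<Sum>i\<in>B. q ^ i))
       \<or> (\<forall>\<^sub>F q in at_left a. (\<Sum>i\<in>B. q ^ i) \<le> (\<Sum>i\<in>A. q ^ i))"
  using poly_sign_at_left[where a = a and p = "(\<Sum>i\<in>B. monom 1 i) - (\<Sum>i\<in>A. monom 1 i)"]
  by (simp add: poly_sum poly_monom)

lemma finite_family_eventually_greatest:
  fixes f :: "'i \<Rightarrow> 'a \<Rightarrow> 'b :: linorder"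
  assumes "finite F" "F \<noteq> {}"
    and comparable: "\<And>i j. i \<in> F \<Longrightarrow> j \<in> F \<Longrightarrow>
      (\<forall>\<^sub>F x in G. f i x \<le> f j x) \<or> (\<forall>\<^sub>F x in G. f j x \<le> f i x)"
  shows "\<exists>m\<in>F. \<forall>\<^sub>F x in G. \<forall>i\<in>F. f i x \<le> f m x"
  using assms
proof (induction F rule: finite_ne_induct)
  case (insert i F)
  then obtain m where m: "m \<in> F" "\<forall>\<^sub>F x in G. \<forall>j\<in>F. f j x \<le> f m x"
    by blast
  have "(\<forall>\<^sub>F x in G. f i x \<le> f m x) \<or> (\<forall>\<^sub>F x in G. f m x \<le> f i x)"
    using insert.prems[of i m] m(1) by simp
  then show ?case
  proof
    assume "\<forall>\<^sub>F x in G. f i x \<le> f m x"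
    with m(2) have "\<forall>\<^sub>F x in G. \<forall>j\<in>insert i F. f j x \<le> f m x"
      by eventually_elim simp
    with m(1) show ?thesis by blast
  next
    assume "\<forall>\<^sub>F x in G. f m x \<le> f i x"
    with m(2) have "\<forall>\<^sub>F x in G. \<forall>j\<in>insert i F. f j x \<le> f i x"
      by eventually_elim (auto intro: order_trans)
    then show ?thesis by blast
  qed
qed simp

definition block :: "nat \<Rightarrow> nat set \<Rightarrow> nat \<Rightarrow> nat set" where
  "block k S n = {i. i < k \<and> n * k + i \<in> S}"

lemma avoiding_block:
  assumes "avoiding D S"
  shows "avoiding D (block k S n)"
  unfolding avoiding_def
proof (intro ballI impI)
  fix x y assume "x \<in> block k S n" "y \<in> block k S n" "x < y"
  then have "n * k + x \<in> S" "n * k + y \<in> S" "n * k + x < n * k + y"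
    by (auto simp: block_def)
  with assms have "(n * k + y) - (n * k + x) \<notin> D"
    unfolding avoiding_def by blast
  then show "y - x \<notin> D" by simp
qed

lemma gen_sum_blocks:
  fixes q :: real
  assumes q: "0 < q" "q < 1" and "0 < k"
  shows "(\<lambda>n. q ^ (n * k) * (\<Sum>i\<in>block k S n. q ^ i)) sums gen_sum S q"
proof -
  define f where "f m = (if m \<in> S then q ^ m else 0)" for m
  have "summable f"
    by (rule summable_comparison_test'[of "\<lambda>m. q ^ m" 0])
      (use q in \<open>auto simp: f_def intro: summable_geometric\<close>)
  moreover have "0 \<le> f m" for m
    using q by (simp add: f_def)
  ultimately have "f sums infsum f UNIV"
    by (intro has_sum_imp_sums has_sum_infsum) (simp add: summable_on_UNIV_nonneg_real_iff)
  moreover have "infsum f UNIV = gen_sum S q"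
    unfolding gen_sum_def by (rule infsum_cong_neutral) (auto simp: f_def)
  ultimately have "f sums gen_sum S q"
    by simp
  from sums_group[OF this \<open>0 < k\<close>]
  have grouped: "(\<lambda>n. sum f {n * k..<n * k + k}) sums gen_sum S q" .
  have "sum f {n * k..<n * k + k} = q ^ (n * k) * (\<Sum>i\<in>block k S n. q ^ i)" for n
  proof -
    have "sum f {n * k..<n * k + k} = (\<Sum>i<k. f (n * k + i))"
      using sum.shift_bounds_nat_ivl[of f 0 "n * k" k]
      by (simp add: add.commute lessThan_atLeast0)
    also have "\<dots> = (\<Sum>i\<in>block k S n. q ^ (n * k + i))"
      by (rule sum.mono_neutral_cong_right) (auto simp: block_def f_def)
    finally show ?thesis
      by (simp add: power_add sum_distrib_left)
  qed
  with grouped show ?thesis by simp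
qed

lemma symmetric_offset_diff_mem:
  assumes "symmetric_with_offset D k" "d \<in> D" "d \<le> k"
  shows "k - d \<in> D"
proof -
  have "int k - int d \<in> int ` D"
    using assms by (auto simp: symmetric_with_offset_def)
  with \<open>d \<le> k\<close> show ?thesis
    by (metis image_iff of_nat_diff of_nat_eq_iff)
qed

text \<open>Two elements of the periodic extension with difference \<open>d \<in> D\<close> have residues modulo \<open>k\<close> that
  differ by \<open>d\<close> or, if a multiple of \<open>k\<close> lies between them, by \<open>k - d\<close> in the opposite order.
  Symmetry rules out the second case just like the first.\<close>

lemma avoiding_periodic_extension:
  assumes sym: "symmetric_with_offset D k" and D: "\<forall>d\<in>D. 0 < d \<and> d < k"
    and I: "avoiding D I"
  shows "avoiding D {n. n mod k \<in> I}"
  unfolding avoiding_def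
proof (intro ballI impI notI)
  fix x y assume "x \<in> {n. n mod k \<in> I}" "y \<in> {n. n mod k \<in> I}" "x < y" and d: "y - x \<in> D"
  then have x: "x mod k \<in> I" and y: "y mod k \<in> I"
    by auto
  define d' where "d' = y - x"
  have bounds: "0 < d'" "d' < k" and y_eq: "y = x + d'"
    using D d \<open>x < y\<close> by (auto simp: d'_def)
  have y_mod: "y mod k = (x mod k + d') mod k"
    by (simp add: y_eq mod_add_left_eq)
  have "x mod k < k"
    using bounds by simp
  show False
  proof (cases "x mod k + d' < k")
    case True
    then have "x mod k < y mod k" "y mod k - x mod k = d'"
      using y_mod bounds by auto
    with I x y d show False
      unfolding avoiding_def d'_def by metis
  next
    case False
    then have "y mod k = x mod k + d' - k"
      using y_mod bounds \<open>x mod k < k\<close> by (simp add: le_mod_geq)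
    then have "y mod k < x mod k" "x mod k - y mod k = k - d'"
      using False bounds by auto
    moreover have "k - d' \<in> D"
      using symmetric_offset_diff_mem[OF sym d] bounds by (simp add: d'_def)
    ultimately show False
      using I x y unfolding avoiding_def by metis
  qed
qed

lemma block_periodic_extension:
  assumes "I \<subseteq> {..<k}"
  shows "block k {n. n mod k \<in> I} n = I"
  using assms by (auto simp: block_def)

theorem corollary5:
  fixes D :: "nat set" and k :: nat
  assumes "finite D" and "D \<noteq> {}" and "\<forall>d\<in>D. 0 < d"
    and "symmetric_with_offset D k"
  shows "\<exists>S. winner D S \<and> (\<exists>d. periodic_with_period S d \<and> d dvd k)"
proof -
  have k: "0 < k" and D: "\<forall>d\<in>D. 0 < d \<and> d < k"
    using assms by (auto simp: symmetric_with_offset_def)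
  define F where "F = {I. I \<subseteq> {..<k} \<and> avoiding D I}"
  define w where "w I q = (\<Sum>i\<in>I. q ^ i)" for I and q :: real
  have "finite F"
    unfolding F_def by (rule finite_subset[of _ "Pow {..<k}"]) auto
  moreover have "F \<noteq> {}"
    by (auto simp: F_def avoiding_def intro!: exI[of _ "{}"])
  moreover have "(\<forall>\<^sub>F q in at_left 1. w A q \<le> w B q) \<or> (\<forall>\<^sub>F q in at_left 1. w B q \<le> w A q)"
    if "A \<in> F" "B \<in> F" for A B
    unfolding w_def using that
    by (intro finite_set_polys_comparable_at_left) (auto simp: F_def intro: finite_subset)
  ultimately obtain I where I: "I \<in> F" and ev: "\<forall>\<^sub>F q in at_left 1. \<forall>A\<in>F. w A q \<le> w I q"
    using finite_family_eventually_greatest[of F w "at_left 1"] by blast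
  obtain b where "b < 1" and best: "\<And>q A. b < q \<Longrightarrow> q < 1 \<Longrightarrow> A \<in> F \<Longrightarrow> w A q \<le> w I q"
    using ev by (auto simp: eventually_at_left_field)
  define S where "S = {n. n mod k \<in> I}"
  have "S' \<preceq> S" if S': "avoiding D S'" for S'
    unfolding germ_le_def
  proof (intro exI conjI ballI)
    show "0 < min 1 (1 - b)" "min 1 (1 - b) \<le> 1"
      using \<open>b < 1\<close> by auto
    fix q :: real assume "q \<in> {1 - min 1 (1 - b)<..<1}"
    then have q: "0 < q" "q < 1" "b < q"
      by auto
    have "block k S' n \<in> F" for n
      using avoiding_block[OF S'] by (auto simp: F_def block_def)
    then have "w (block k S' n) q \<le> w (block k S n) q" for n
      using best q I by (simp add: S_def F_def block_periodic_extension)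
    then have "q ^ (n * k) * w (block k S' n) q \<le> q ^ (n * k) * w (block k S n) q" for n
      using q by (intro mult_left_mono) auto
    then show "gen_sum S' q \<le> gen_sum S q"
      using gen_sum_blocks[OF q(1,2) k, of S'] gen_sum_blocks[OF q(1,2) k, of S]
      unfolding w_def by (rule sums_le)
  qed
  moreover have "avoiding D S"
    using avoiding_periodic_extension[OF assms(4) D] I by (simp add: S_def F_def)
  ultimately have "winner D S"
    by (simp add: winner_def)
  moreover have "periodic_with_period S k"
    using k by (simp add: periodic_with_period_def S_def)
  ultimately show ?thesis
    using dvd_refl by metis
qed

end
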